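(* Let $k\ge 3$ be a fixed integer. For all sufficiently large $n$ (depending on $k$), \[ f(n,k,3,1)= \binom{n-k-1}{k-1}+1, \] and a $3$-cluster-free family $\mathcal{F}\subset\binom{[n]}{k}$ with matching number at least $2$ attains this size only if $\mathcal{F}$ is the disjoint union of a $k$-set and a star, i.e. only if there are a $k$-set $B\subset[n]$ and a vertex $x\in[n]\setminus B$ such that $\mathcal{F}=\{B\}\cup\left\{F\in\binom{[n]\setminus B}{k}:x\in F\right\}$.
   Context: $[n]=\{1,\dots,n\}$, and $\binom{V}{k}$ is the collection of all $k$-element subsets of a set $V$. A $d$-cluster of $k$-sets is a collection of $d$ different $k$-sets $A_1,\dots,A_d$ with $|A_1\cup\dots\cup A_d|\le 2k$ and $A_1\cap\dots\cap A_d=\emptyset$. A family $\mathcal{F}\subset\binom{[n]}{k}$ is $d$-cluster-free if it contains no $d$-cluster. The matching number $\nu(\mathcal{F})$ is the maximum number of pairwise disjoint sets in $\mathcal{F}$. $f(n,k,d,\nu)$ is the maximum size of a $d$-cluster-free family $\mathcal{F}\subset\binom{[n]}{k}$ with $\nu(\mathcal{F})\ge\nu+1$; in particular $f(n,k,d,1)$ is the maximum size of a $d$-cluster-free family that is not intersecting. A star is a family of $k$-sets containing a fixed vertex. *)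

theory Defs
  imports Main "HOL-Library.Ramsey" "HOL-Library.Disjoint_Sets"
begin

text \<open>The collection of \<open>k\<close>-element subsets of \<open>V\<close> is the library's \<open>nsets V k\<close>, written
  \<open>[V]\<^bsup>k\<^esup>\<close>.\<close>

definition is_cluster :: "nat \<Rightarrow> nat \<Rightarrow> 'a set set \<Rightarrow> bool" where
  "is_cluster k d \<A> \<longleftrightarrow>
     finite \<A> \<and> card \<A> = d \<and> \<A> \<subseteq> [UNIV]\<^bsup>k\<^esup> \<and> card (\<Union>\<A>) \<le> 2 * k \<and> \<Inter>\<A> = {}"

definition cluster_free :: "nat \<Rightarrow> nat \<Rightarrow> 'a set set \<Rightarrow> bool" where
  "cluster_free k d \<F> \<longleftrightarrow> \<not> (\<exists>\<A>\<subseteq>\<F>. is_cluster k d \<A>)"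

text \<open>Meaningful for finite families only.\<close>

definition matching_number :: "'a set set \<Rightarrow> nat" where
  "matching_number \<F> = Max (card ` {\<M>. \<M> \<subseteq> \<F> \<and> disjoint \<M>})"

definition admissible :: "nat \<Rightarrow> nat \<Rightarrow> nat \<Rightarrow> nat \<Rightarrow> nat set set \<Rightarrow> bool" where
  "admissible n k d \<nu> \<F> \<longleftrightarrow>
     \<F> \<subseteq> [{1..n}]\<^bsup>k\<^esup> \<and> cluster_free k d \<F> \<and> matching_number \<F> \<ge> \<nu> + 1"

text \<open>The extremal function \<open>f(n,k,d,\<nu>)\<close>. It is unspecified when no family is admissible, which
  does not happen for \<open>k \<ge> 1\<close>, \<open>d = 3\<close>, \<open>\<nu> = 1\<close> and \<open>n \<ge> 2 * k\<close>: two disjoint \<open>k\<close>-sets form an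
  admissible family.\<close>

definition max_cluster_free :: "nat \<Rightarrow> nat \<Rightarrow> nat \<Rightarrow> nat \<Rightarrow> nat" where
  "max_cluster_free n k d \<nu> = Max {card \<F> |\<F>. admissible n k d \<nu> \<F>}"

end

theory Submission
  imports Defs
begin

text \<open>Call a \<open>(k - 1)\<close>-subset \<open>A - {y}\<close> of a member \<open>A\<close> own if no other member contains it. If it is not
  own, no member meets \<open>A\<close> in exactly \<open>{y}\<close>: together with a second member containing \<open>A - {y}\<close> it
  would form a cluster. So members without own subsets never meet in one point and there are only
  \<open>O(n\<^sup>k\<^sup>-\<^sup>2)\<close> of them. As own subsets are distinct and the family has \<open>n\<^sup>k\<^sup>-\<^sup>1/(k-1)! - O(n\<^sup>k\<^sup>-\<^sup>2)\<close>
  members, all but \<open>O(n\<^sup>k\<^sup>-\<^sup>2)\<close> members have exactly one own subset \<open>A - {ctr A}\<close>, and only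
  \<open>O(n\<^sup>k\<^sup>-\<^sup>2)\<close> sets of size \<open>k - 1\<close> lie in several members. Deleting members through such sets of small
  degree leaves a core in which every element except \<open>ctr A\<close> can be exchanged for many others.
  Exchanging elements one at a time shows that intersecting core members have the same centre;
  hence the cores of different centres have disjoint supports, and by convexity one support misses
  only \<open>O(1)\<close> vertices. Exchanging once more, every member \<open>B\<close> avoiding its centre \<open>x\<close> is disjoint
  from this support, so there are \<open>O(1)\<close> such \<open>B\<close>. Finally, a member \<open>A\<close> through \<open>x\<close> that meets \<open>B\<close>
  excludes every set through \<open>x\<close> which is disjoint from \<open>B\<close> and contains \<open>A - B\<close>; these are so
  numerous that having such an \<open>A\<close>, or a second \<open>B\<close>, only loses.\<close>

section \<open>Counting subsets\<close>

lemma card_UN_le_mult: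
  assumes "finite I" and "\<And>i. i \<in> I \<Longrightarrow> card (f i) \<le> b"
  shows "card (\<Union>i\<in>I. f i) \<le> card I * b"
  using card_UN_le[OF assms(1), of f] sum_bounded_above[of I "\<lambda>i. card (f i)" b] assms(2)
  by force

lemma double_count_le:
  fixes a b :: nat
  assumes "finite P" "finite M"
    and "\<And>p. p \<in> P \<Longrightarrow> a \<le> card {m \<in> M. R p m}"
    and "\<And>m. m \<in> M \<Longrightarrow> card {p \<in> P. R p m} \<le> b"
  shows "a * card P \<le> b * card M"
proof -
  have "a * card P \<le> (\<Sum>p\<in>P. card {m \<in> M. R p m})"
    using sum_bounded_below[of P a] assms(3) by (simp add: mult.commute)
  also have "\<dots> = (\<Sum>m\<in>M. card {p \<in> P. R p m})"
    by (rule sum_multicount_gen) (use assms in auto)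
  also have "\<dots> \<le> b * card M"
    using sum_bounded_above[of M "\<lambda>m. card {p \<in> P. R p m}" b] assms(4) by (simp add: mult.commute)
  finally show ?thesis .
qed

lemma binomial_le_power: "n choose k \<le> n ^ k"
  using binomial_fact_pow[of n k] fact_ge_1[of k, where 'a=nat]
  by (metis le_trans mult_le_mono2 mult.right_neutral)

text \<open>Passing from \<open>j\<close> to \<open>Suc j\<close> replaces a factor \<open>n\<close>
  by \<open>n - j\<close> and so loses at most \<open>j * n ^ j\<close>. The losses fit into the
  error term because j^2 + j <= (j + 1)^2.\<close>

lemma power_le_fact_binomial: "n ^ j \<le> fact j * (n choose j) + j ^ 2 * n ^ (j - 1)"
proof (induction j)
  case 0
  show ?case by simp
next
  case (Suc j)
  have abs: "Suc j * (n choose Suc j) = (n - j) * (n choose j)"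
    by (metis binomial_absorb_comp binomial_absorption)
  have "n ^ Suc j \<le> n * (fact j * (n choose j) + j ^ 2 * n ^ (j - 1))"
    using Suc.IH by simp
  also have "\<dots> = fact j * (n * (n choose j)) + j ^ 2 * n ^ j"
    by (cases j) (auto simp: algebra_simps)
  also have "n * (n choose j) \<le> (n - j) * (n choose j) + j * (n choose j)"
    by (metis add_mult_distrib diff_add le_add_diff_inverse2 linorder_linear mult_le_mono1 le_add2 diff_is_0_eq add_0)
  also have "fact j * ((n - j) * (n choose j) + j * (n choose j)) + j ^ 2 * n ^ j
      = fact (Suc j) * (n choose Suc j) + j * ((n choose j) * fact j) + j ^ 2 * n ^ j"
    by (simp only: abs[symmetric] fact_Suc) (simp add: algebra_simps)
  also have "\<dots> \<le> fact (Suc j) * (n choose Suc j) + j * n ^ j + j ^ 2 * n ^ j"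
    using binomial_fact_pow[of n j] by (intro add_mono mult_left_mono) auto
  also have "\<dots> \<le> fact (Suc j) * (n choose Suc j) + (Suc j) ^ 2 * n ^ j"
    by (simp add: power2_eq_square algebra_simps)
  finally show ?case by simp
qed

text \<open>By Pascal's rule, lowering the upper index by one costs one coefficient with lower index
  \<open>j - 1\<close>, hence at most \<open>n ^ (j - 1)\<close>.\<close>

lemma binomial_le_binomial_diff:
  assumes "j \<ge> 1"
  shows "n choose j \<le> ((n - t) choose j) + t * n ^ (j - 1)"
proof (induction t)
  case 0
  show ?case by simp
next
  case (Suc t)
  have "(n - t) choose j \<le> ((n - Suc t) choose j) + n ^ (j - 1)"
  proof (cases "n - t")
    case (Suc m)
    obtain i where i: "j = Suc i" using assms by (cases j) auto
    have "m choose i \<le> m ^ i" by (rule binomial_le_power)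
    also have "\<dots> \<le> n ^ i" using Suc by (intro power_mono) auto
    finally have "Suc m choose j \<le> (m choose j) + n ^ (j - 1)" by (simp add: i)
    moreover have "n - Suc t = m" using Suc by simp
    ultimately show ?thesis using Suc by simp
  qed (use assms in \<open>auto simp: binomial_eq_0\<close>)
  then show ?case using Suc.IH by simp
qed

section \<open>Supersets of a fixed set and deletion of small degrees\<close>

lemma card_supersets_le:
  assumes "finite X" "T \<subseteq> X"
  shows "card {A \<in> [X]\<^bsup>k\<^esup>. T \<subseteq> A} \<le> card X ^ (k - card T)"
proof -
  have "finite T" using assms finite_subset by blast
  have "inj_on (\<lambda>A. A - T) {A \<in> [X]\<^bsup>k\<^esup>. T \<subseteq> A}"
    by (rule inj_onI) blast
  moreover have "(\<lambda>A. A - T) ` {A \<in> [X]\<^bsup>k\<^esup>. T \<subseteq> A} \<subseteq> nsets X (k - card T)"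
    using \<open>finite T\<close> by (auto simp: nsets_def card_Diff_subset)
  ultimately have "card {A \<in> [X]\<^bsup>k\<^esup>. T \<subseteq> A} \<le> card (nsets X (k - card T))"
    by (intro card_inj_on_le) (auto simp: assms finite_imp_finite_nsets)
  then show ?thesis
    using binomial_le_power[of "card X" "k - card T"] by simp
qed

text \<open>\<open>P\<close> is first enlarged to exactly \<open>m\<close> elements; each further
  point of \<open>Y\<close> then gives a different superset.\<close>

lemma card_supersets_ge:
  assumes "finite Y" "P \<subseteq> Y" "card P \<le> m"
  shows "card Y - m \<le> card {Q \<in> [Y]\<^bsup>Suc m\<^esup>. P \<subseteq> Q}"
proof (cases "m \<le> card Y")
  case True
  then obtain P1 where P1: "P \<subseteq> P1" "P1 \<subseteq> Y" "card P1 = m"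
    using exists_subset_between[of P m Y] assms by auto
  have fin: "finite P1" using P1(2) assms(1) finite_subset by blast
  have "inj_on (\<lambda>z. insert z P1) (Y - P1)"
    by (rule inj_onI) blast
  moreover have "(\<lambda>z. insert z P1) ` (Y - P1) \<subseteq> {Q \<in> [Y]\<^bsup>Suc m\<^esup>. P \<subseteq> Q}"
    using P1 fin by (auto simp: nsets_def)
  ultimately have "card (Y - P1) \<le> card {Q \<in> [Y]\<^bsup>Suc m\<^esup>. P \<subseteq> Q}"
    by (intro card_inj_on_le) (auto simp: assms finite_imp_finite_nsets)
  then show ?thesis
    using P1 fin by (simp add: card_Diff_subset)
qed auto

text \<open>Delete all members above some \<open>S\<close> whose degree is positive but at most
  \<open>K\<close>. Then \<open>S\<close> has degree zero, so each \<open>S\<close> is treated at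
  most once and costs at most \<open>K\<close> members.\<close>

lemma peeling:
  assumes "finite D" "finite \<F>"
  shows "\<exists>\<G>\<subseteq>\<F>. card (\<F> - \<G>) \<le> K * card D \<and>
    (\<forall>S\<in>D. (\<exists>A\<in>\<G>. S \<subseteq> A) \<longrightarrow> K < card {A \<in> \<G>. S \<subseteq> A})"
  using assms
proof (induction "card D" arbitrary: D \<F>)
  case 0
  then show ?case by auto
next
  case (Suc m)
  show ?case
  proof (cases "\<forall>S\<in>D. (\<exists>A\<in>\<F>. S \<subseteq> A) \<longrightarrow> K < card {A \<in> \<F>. S \<subseteq> A}")
    case True
    then show ?thesis by (intro exI[of _ \<F>]) auto
  next
    case False
    then obtain S where S: "S \<in> D" "card {A \<in> \<F>. S \<subseteq> A} \<le> K" by fastforce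
    define \<F>' where "\<F>' = {A \<in> \<F>. \<not> S \<subseteq> A}"
    have m: "m = card (D - {S})" using Suc.hyps(2) S(1) Suc.prems by simp
    obtain \<G> where \<G>: "\<G> \<subseteq> \<F>'" "card (\<F>' - \<G>) \<le> K * card (D - {S})"
      "\<forall>S\<in>D - {S}. (\<exists>A\<in>\<G>. S \<subseteq> A) \<longrightarrow> K < card {A \<in> \<G>. S \<subseteq> A}"
      using Suc.hyps(1)[OF m, of \<F>'] Suc.prems \<F>'_def by auto
    have "\<F> - \<G> \<subseteq> {A \<in> \<F>. S \<subseteq> A} \<union> (\<F>' - \<G>)" by (auto simp: \<F>'_def)
    then have "card (\<F> - \<G>) \<le> card ({A \<in> \<F>. S \<subseteq> A} \<union> (\<F>' - \<G>))"
      by (intro card_mono) (use Suc.prems \<F>'_def in auto)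
    also have "\<dots> \<le> card {A \<in> \<F>. S \<subseteq> A} + card (\<F>' - \<G>)" by (rule card_Un_le)
    also have "\<dots> \<le> K + K * m" using S \<G>(2) m by simp
    also have "\<dots> = K * card D" using Suc.hyps(2) by (metis mult_Suc_right)
    finally have "card (\<F> - \<G>) \<le> K * card D" .
    moreover have "\<G> \<subseteq> \<F>" "\<forall>A\<in>\<G>. \<not> S \<subseteq> A" using \<G>(1) by (auto simp: \<F>'_def)
    ultimately show ?thesis using \<G>(3) by blast
  qed
qed

text \<open>Fixing a member \<open>M u\<close> through each \<open>u\<close>, any other member through \<open>u\<close> contains a further element
  of \<open>M u\<close>. Following these choices inside a member yields three vertices \<open>u, v, w\<close> with \<open>O(n)\<close>
  possibilities or, if the choices pair up the vertices, four with \<open>O(n\<^sup>2)\<close> possibilities.\<close>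

lemma card_avoiding_singleton_intersections:
  assumes X: "finite X" and H: "H \<subseteq> [X]\<^bsup>k\<^esup>" and k: "k \<ge> 3"
    and avoid: "\<And>A B. A \<in> H \<Longrightarrow> B \<in> H \<Longrightarrow> card (A \<inter> B) \<noteq> 1"
  shows "card H \<le> 2 * k ^ 2 * card X ^ (k - 2)"
proof -
  define M where "M u = (SOME A. A \<in> H \<and> u \<in> A)" for u
  \<comment> \<open>\<open>N u\<close> collects the possible successors of \<open>u\<close>; the
    default \<open>{}\<close> keeps it inside \<open>X\<close> when no member contains
    \<open>u\<close>.\<close>
  define N where "N u = (if u \<in> \<Union>H then M u - {u} else {})" for u
  have M: "M u \<in> H \<and> u \<in> M u" if "u \<in> A" "A \<in> H" for u A
    unfolding M_def by (rule someI[of _ A]) (use that in auto)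
  have HX: "A \<subseteq> X \<and> card A = k \<and> finite A" if "A \<in> H" for A
    using that H by (auto simp: nsets_def)
  have NX: "N u \<subseteq> X" for u
    unfolding N_def using M HX by (simp split: if_splits) blast
  have Nfin: "finite (N u)" for u using NX X finite_subset by blast
  have Ncard: "card (N u) \<le> k" for u
  proof (cases "u \<in> \<Union>H")
    case True
    then have "card (M u) = k" using M HX by blast
    then have "card (M u - {u}) \<le> k" by (metis card_Diff1_le)
    then show ?thesis using True by (simp add: N_def)
  qed (simp add: N_def)
  have succ: "\<exists>v\<in>A. v \<in> N u" if "A \<in> H" "u \<in> A" for A u
  proof (rule ccontr)
    assume "\<not> ?thesis"
    moreover have "N u = M u - {u}" using that by (auto simp: N_def)
    ultimately have "A \<inter> M u = {u}" using that M[of u A] by auto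
    then show False using avoid[of A "M u"] M[of u A] that by simp
  qed
  define T3 where "T3 = {(u, v, w). u \<in> X \<and> v \<in> N u \<and> w \<in> N v \<and> card {u, v, w} = 3}"
  define T4 where "T4 = {(a, b, c, d). a \<in> X \<and> b \<in> N a \<and> c \<in> X \<and> d \<in> N c \<and> card {a, b, c, d} = 4}"
  define f3 where "f3 = (\<lambda>(u, v, w). {A \<in> [X]\<^bsup>k\<^esup>. {u, v, w} \<subseteq> A})"
  define f4 where "f4 = (\<lambda>(a, b, c, d). {A \<in> [X]\<^bsup>k\<^esup>. {a, b, c, d} \<subseteq> A})"
  have T3sub: "T3 \<subseteq> (SIGMA u:X. SIGMA v:N u. N v)" by (auto simp: T3_def)
  have fin3: "finite (SIGMA u:X. SIGMA v:N u. N v)" using X Nfin by auto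
  have cE: "card (SIGMA u:X. N u) \<le> card X * k"
    using X Nfin Ncard by (simp add: sum_bounded_above[of X _ k, simplified])
  have c3': "card (SIGMA v:N u. N v) \<le> k * k" for u
  proof -
    have "card (SIGMA v:N u. N v) \<le> card (N u) * k"
      using Nfin Ncard sum_bounded_above[of "N u" "\<lambda>v. card (N v)" k] by simp
    also have "\<dots> \<le> k * k" using Ncard by simp
    finally show ?thesis .
  qed
  have c3: "card T3 \<le> card X * (k * k)"
  proof -
    have "card T3 \<le> card (SIGMA u:X. SIGMA v:N u. N v)" by (rule card_mono[OF fin3 T3sub])
    also have "\<dots> = (\<Sum>u\<in>X. card (SIGMA v:N u. N v))"
      using X Nfin by (intro card_SigmaI) auto
    also have "\<dots> \<le> card X * (k * k)"
      using sum_bounded_above[of X "\<lambda>u. card (SIGMA v:N u. N v)" "k * k"] c3' by simp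
    finally show ?thesis .
  qed
  have "inj_on (\<lambda>(a, b, c, d). ((a, b), (c, d))) T4" by (auto simp: inj_on_def)
  moreover have "(\<lambda>(a, b, c, d). ((a, b), (c, d))) ` T4 \<subseteq> (SIGMA u:X. N u) \<times> (SIGMA u:X. N u)"
    by (auto simp: T4_def)
  moreover have finE: "finite ((SIGMA u:X. N u) \<times> (SIGMA u:X. N u))" using X Nfin by auto
  ultimately have fin4: "finite T4"
    and "card T4 \<le> card ((SIGMA u:X. N u) \<times> (SIGMA u:X. N u))"
    by (auto intro: card_inj_on_le inj_on_finite)
  note this(2)
  also have "card ((SIGMA u:X. N u) \<times> (SIGMA u:X. N u)) \<le> (card X * k) * (card X * k)"
    unfolding card_cartesian_product using cE by (rule mult_mono) (use cE in auto)
  finally have c4: "card T4 \<le> (card X * k) * (card X * k)" .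
  have "H \<subseteq> (\<Union>t\<in>T3. f3 t) \<union> (\<Union>t\<in>T4. f4 t)"
  proof
    fix A assume A: "A \<in> H"
    have AX: "A \<subseteq> X" "card A = k" "finite A" "A \<in> [X]\<^bsup>k\<^esup>" using A H by (auto simp: nsets_def)
    obtain f where f: "\<And>u. u \<in> A \<Longrightarrow> f u \<in> A \<and> f u \<in> N u" using succ[OF A] by metis
    have fne: "f u \<noteq> u" if "u \<in> A" for u using f[OF that] by (auto simp: N_def split: if_splits)
    show "A \<in> (\<Union>t\<in>T3. f3 t) \<union> (\<Union>t\<in>T4. f4 t)"
    \<comment> \<open>Two successor steps reach three distinct vertices unless \<open>f\<close> is a
      fixed-point-free involution on \<open>A\<close>; in that case two of its pairs give
      four.\<close>
    proof (cases "\<exists>u\<in>A. f (f u) \<noteq> u")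
      case True
      then obtain u where u: "u \<in> A" "f (f u) \<noteq> u" by blast
      moreover have "f u \<noteq> u" "f (f u) \<noteq> f u" using u f fne by auto
      ultimately have "(u, f u, f (f u)) \<in> T3" "A \<in> f3 (u, f u, f (f u))"
        using f AX by (auto simp: T3_def f3_def card_insert_if)
      then show ?thesis by blast
    next
      case False
      obtain a where a: "a \<in> A" using AX k by fastforce
      have "\<not> A \<subseteq> {a, f a}"
      proof
        assume "A \<subseteq> {a, f a}"
        then have "card A \<le> card {a, f a}" by (intro card_mono) auto
        also have "\<dots> \<le> 2" by (simp add: card_insert_if)
        finally show False using AX k by simp
      qed
      then obtain c where c: "c \<in> A" "c \<noteq> a" "c \<noteq> f a" by blast
      have "f c \<noteq> a" "f c \<noteq> f a" using False a c by metis+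
      moreover have "f a \<noteq> a" "f c \<noteq> c" using a c fne by auto
      ultimately have "(a, f a, c, f c) \<in> T4" "A \<in> f4 (a, f a, c, f c)"
        using f AX a c by (auto simp: T4_def f4_def card_insert_if)
      then show ?thesis by blast
    qed
  qed
  moreover have "finite (\<Union>t\<in>T3. f3 t)" "finite (\<Union>t\<in>T4. f4 t)"
    using X finite_imp_finite_nsets[OF X, of k] fin4 finite_subset[OF T3sub fin3]
    by (auto simp: f3_def f4_def)
  ultimately have "card H \<le> card ((\<Union>t\<in>T3. f3 t) \<union> (\<Union>t\<in>T4. f4 t))" by (intro card_mono) auto
  also have "\<dots> \<le> card (\<Union>t\<in>T3. f3 t) + card (\<Union>t\<in>T4. f4 t)" by (rule card_Un_le)
  also have "card (\<Union>t\<in>T3. f3 t) \<le> k ^ 2 * card X ^ (k - 2)"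
  proof -
    have "card (\<Union>t\<in>T3. f3 t) \<le> card T3 * card X ^ (k - 3)"
    proof (rule card_UN_le_mult)
      fix t assume "t \<in> T3"
      then obtain u v w where t: "t = (u, v, w)" "{u, v, w} \<subseteq> X" "card {u, v, w} = 3"
        using NX by (fastforce simp: T3_def)
      then show "card (f3 t) \<le> card X ^ (k - 3)"
        using card_supersets_le[OF X t(2), of k] unfolding f3_def by simp
    qed (rule finite_subset[OF T3sub fin3])
    also have "\<dots> \<le> (card X * (k * k)) * card X ^ (k - 3)" using c3 by (rule mult_right_mono) simp
    also have "\<dots> = k ^ 2 * card X ^ Suc (k - 3)" by (simp add: power2_eq_square)
    also have "Suc (k - 3) = k - 2" using k by simp
    finally show ?thesis .
  qed
  also have "card (\<Union>t\<in>T4. f4 t) \<le> k ^ 2 * card X ^ (k - 2)"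
  \<comment> \<open>For \<open>k = 3\<close> the exponent \<open>k - 4\<close> truncates to 0 and
    the bound on \<open>T4\<close> would be one power too large, but a 3-set contains no four points
    anyway.\<close>
  proof (cases "k = 3")
    case True
    have "f4 t = {}" if t4: "t \<in> T4" for t
    proof -
      obtain a b c d where t: "t = (a, b, c, d)" "card {a, b, c, d} = 4"
        using t4 unfolding T4_def by blast
      have "\<not> {a, b, c, d} \<subseteq> A" if "A \<in> [X]\<^bsup>k\<^esup>" for A
        using card_mono[of A "{a, b, c, d}"] that True t(2) by (auto simp: nsets_def)
      then show ?thesis using t(1) by (auto simp: f4_def)
    qed
    then show ?thesis by simp
  next
    case False
    have "card (\<Union>t\<in>T4. f4 t) \<le> card T4 * card X ^ (k - 4)"
    proof (rule card_UN_le_mult)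
      fix t assume "t \<in> T4"
      then obtain a b c d where t: "t = (a, b, c, d)" "{a, b, c, d} \<subseteq> X" "card {a, b, c, d} = 4"
        using NX by (fastforce simp: T4_def)
      then show "card (f4 t) \<le> card X ^ (k - 4)"
        using card_supersets_le[OF X t(2), of k] unfolding f4_def by simp
    qed (rule fin4)
    also have "\<dots> \<le> ((card X * k) * (card X * k)) * card X ^ (k - 4)"
      using c4 by (rule mult_right_mono) simp
    also have "\<dots> = k ^ 2 * card X ^ Suc (Suc (k - 4))" by (simp add: power2_eq_square)
    also have "Suc (Suc (k - 4)) = k - 2" using k False by simp
    finally show ?thesis .
  qed
  finally show ?thesis by simp
qed

section \<open>Own subsets and the exchange core\<close>

locale three_cluster_free =
  fixes X :: "'a set" and k :: nat and \<F> :: "'a set set"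
  assumes finite_X: "finite X"
    and k_ge_3: "k \<ge> 3"
    and \<F>_sub: "\<F> \<subseteq> [X]\<^bsup>k\<^esup>"
    and cluster_free: "cluster_free k 3 \<F>"
begin

lemma memD:
  assumes "A \<in> \<F>"
  shows "A \<subseteq> X" "finite A" "card A = k"
  using assms \<F>_sub by (auto simp: nsets_def)

lemma finite_\<F>: "finite \<F>"
  using \<F>_sub finite_imp_finite_nsets[OF finite_X] finite_subset by blast

lemma no_cluster:
  assumes "A \<in> \<F>" "B \<in> \<F>" "C \<in> \<F>" "A \<noteq> B" "A \<noteq> C" "B \<noteq> C"
    and "A \<inter> B \<inter> C = {}"
  shows "2 * k < card (A \<union> B \<union> C)"
proof (rule ccontr)
  assume "\<not> ?thesis"
  then have "is_cluster k 3 {A, B, C}"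
    using assms memD by (auto simp: is_cluster_def nsets_def Un_assoc Int_assoc)
  moreover have "{A, B, C} \<subseteq> \<F>" using assms by simp
  ultimately show False using cluster_free unfolding cluster_free_def by blast
qed

text \<open>The subset is recorded through its deleted point \<open>y\<close>, which is meant to lie
  in \<open>A\<close>; equality with \<open>{A}\<close> also makes \<open>A\<close> a
  member.\<close>

definition own :: "'a set \<Rightarrow> 'a \<Rightarrow> bool" where
  "own A y \<longleftrightarrow> {B \<in> \<F>. A - {y} \<subseteq> B} = {A}"

text \<open>A second member \<open>B\<close> above \<open>A - {y}\<close> misses \<open>y\<close>,
  so \<open>A \<inter> C = {y}\<close> would leave no point common to all three. Their union would
  have at most \<open>2 * k\<close> points: \<open>B\<close> adds one to \<open>A\<close>, and
  \<open>C\<close> adds at most \<open>k - 1\<close>.\<close>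

lemma not_own_inter:
  assumes A: "A \<in> \<F>" "y \<in> A" "\<not> own A y" and C: "C \<in> \<F>"
  shows "A \<inter> C \<noteq> {y}"
proof
  assume AC: "A \<inter> C = {y}"
  obtain B where B: "B \<in> \<F>" "A - {y} \<subseteq> B" "B \<noteq> A"
    using A unfolding own_def by blast
  have cA: "card (A - {y}) = k - 1" using A memD by simp
  have "\<not> A \<subseteq> B" using B A memD card_subset_eq by metis
  then have "y \<notin> B" using B(2) by blast
  have "C \<noteq> A" using AC memD(3)[OF C] k_ge_3 by auto
  have "y \<in> C" using AC by blast
  have "C \<noteq> B"
  proof
    assume "C = B"
    then have "A - {y} = {}" using AC B(2) by blast
    then have "card (A - {y}) = 0" by (simp only: card.empty)
    then show False using cA k_ge_3 by simp
  qed
  have "A \<inter> B \<inter> C = A \<inter> C \<inter> B" by blast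
  then have "A \<inter> B \<inter> C = {}" using AC \<open>y \<notin> B\<close> by simp
  then have big: "2 * k < card (A \<union> B \<union> C)"
    using no_cluster A(1) B(1) C B(3) \<open>C \<noteq> A\<close> \<open>C \<noteq> B\<close> by metis
  have "A \<union> B \<union> C = A \<union> (B - (A - {y})) \<union> (C - {y})" using A(2) B(2) by blast
  then have "card (A \<union> B \<union> C) \<le> card A + card (B - (A - {y})) + card (C - {y})"
    by (metis (no_types, lifting) card_Un_le add_le_mono1 le_trans)
  also have "card (B - (A - {y})) = 1"
    using memD[OF A(1)] memD[OF B(1)] B(2) cA k_ge_3 by (simp add: card_Diff_subset)
  also have "card (C - {y}) = k - 1" using memD[OF C] \<open>y \<in> C\<close> by simp
  finally show False using big k_ge_3 memD(3)[OF A(1)] by simp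
qed

lemma card_no_own: "card {A \<in> \<F>. \<forall>y\<in>A. \<not> own A y} \<le> 2 * k ^ 2 * card X ^ (k - 2)"
proof (rule card_avoiding_singleton_intersections[OF finite_X _ k_ge_3])
  fix A B assume "A \<in> {A \<in> \<F>. \<forall>y\<in>A. \<not> own A y}" "B \<in> {A \<in> \<F>. \<forall>y\<in>A. \<not> own A y}"
  then show "card (A \<inter> B) \<noteq> 1"
    using not_own_inter by (force simp: card_1_singleton_iff)
qed (use \<F>_sub in auto)

text \<open>An own subset determines its member, so \<open>(A, y) \<mapsto> A - {y}\<close> is
  injective on own pairs and hits only sets of degree one. These are disjoint from \<open>D\<close>,
  and members with several own subsets are counted at least twice.\<close>

lemma card_shadow:
  defines "D \<equiv> {S \<in> nsets X (k - 1). 2 \<le> card {A \<in> \<F>. S \<subseteq> A}}"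
  shows "card {A \<in> \<F>. \<exists>!y. y \<in> A \<and> own A y}
    + 2 * card {A \<in> \<F>. (\<exists>y\<in>A. own A y) \<and> \<not> (\<exists>!y. y \<in> A \<and> own A y)}
    + card D \<le> card X choose (k - 1)"
    (is "card ?F1 + 2 * card ?F2 + _ \<le> _")
proof -
  define W where "W A = {y \<in> A. own A y}" for A
  define P where "P = {S \<in> nsets X (k - 1). card {A \<in> \<F>. S \<subseteq> A} = 1}"
  have finW: "finite (W A)" if "A \<in> \<F>" for A using that memD by (simp add: W_def)
  have finn: "finite (nsets X (k - 1))" by (rule finite_imp_finite_nsets[OF finite_X])
  have W1: "1 \<le> card (W A)" if "A \<in> ?F1" for A
  proof -
    have "W A \<noteq> {}" using that by (auto simp: W_def)
    then show ?thesis using finW that by (simp add: Suc_leI card_gt_0_iff)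
  qed
  have W2: "2 \<le> card (W A)" if A: "A \<in> ?F2" for A
  proof -
    obtain y z where "y \<in> W A" "z \<in> W A" "y \<noteq> z" using A unfolding W_def by blast
    then have "card {y, z} \<le> card (W A)" using finW A by (intro card_mono) auto
    then show ?thesis using \<open>y \<noteq> z\<close> by simp
  qed
  have "card ?F1 + 2 * card ?F2 \<le> (\<Sum>A\<in>?F1. card (W A)) + (\<Sum>A\<in>?F2. card (W A))"
    using sum_bounded_below[of ?F1 1 "\<lambda>A. card (W A)"] sum_bounded_below[of ?F2 2 "\<lambda>A. card (W A)"] W1 W2
    by fastforce
  also have "\<dots> = (\<Sum>A\<in>?F1 \<union> ?F2. card (W A))"
    by (rule sum.union_disjoint[symmetric]) (auto simp: finite_\<F>)
  also have "\<dots> \<le> (\<Sum>A\<in>\<F>. card (W A))"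
    by (rule sum_mono2) (auto simp: finite_\<F>)
  also have "\<dots> = card (SIGMA A:\<F>. W A)"
    by (rule card_SigmaI[symmetric]) (use finW finite_\<F> in auto)
  also have "\<dots> \<le> card P"
  proof (rule card_inj_on_le)
    show "inj_on (\<lambda>(A, y). A - {y}) (SIGMA A:\<F>. W A)"
    proof (rule inj_onI, clarsimp)
      fix A y B z assume *: "A \<in> \<F>" "y \<in> W A" "B \<in> \<F>" "z \<in> W B" and eq: "A - {y} = B - {z}"
      then have "{A} = {C \<in> \<F>. A - {y} \<subseteq> C}" "{B} = {C \<in> \<F>. B - {z} \<subseteq> C}"
        unfolding W_def own_def by simp_all
      then have "{A} = {B}" using eq by simp
      then show "A = B \<and> y = z" using eq * unfolding W_def by blast
    qed
    show "(\<lambda>(A, y). A - {y}) ` (SIGMA A:\<F>. W A) \<subseteq> P"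
      using memD by (auto simp: P_def W_def own_def nsets_def)
    show "finite P" using finn by (simp add: P_def)
  qed
  finally have "card ?F1 + 2 * card ?F2 + card D \<le> card P + card D" by simp
  also have "\<dots> = card (P \<union> D)"
    by (rule card_Un_disjoint[symmetric]) (use finn in \<open>auto simp: P_def D_def\<close>)
  also have "\<dots> \<le> card (nsets X (k - 1))"
    by (rule card_mono[OF finn]) (auto simp: P_def D_def)
  finally show ?thesis by simp
qed

end

section \<open>Exchange arguments in the core\<close>

locale swappable_core = three_cluster_free +
  fixes \<G> :: "'a set set" and ctr :: "'a set \<Rightarrow> 'a"
  assumes \<G>_sub: "\<G> \<subseteq> \<F>"
    and ctr_in: "A \<in> \<G> \<Longrightarrow> ctr A \<in> A"
    and many_swaps: "A \<in> \<G> \<Longrightarrow> y \<in> A \<Longrightarrow> y \<noteq> ctr A \<Longrightarrow> 3 * k < card {B \<in> \<G>. A - {y} \<subseteq> B}"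
begin

text \<open>Each core member above \<open>A - {y}\<close> adds a single point. There are more than
  \<open>3 * k\<close> of them, while \<open>Z \<union> A\<close> offers at most
  \<open>2 * k + k\<close> points.\<close>

lemma swap:
  assumes A: "A \<in> \<G>" "y \<in> A" "y \<noteq> ctr A" and Z: "finite Z" "card Z \<le> 2 * k"
  obtains z where "z \<notin> Z" "z \<notin> A" "insert z (A - {y}) \<in> \<G>"
proof (rule ccontr)
  assume no: "\<not> thesis"
  note found = that
  have none: "insert z (A - {y}) \<notin> \<G>" if z: "z \<notin> Z" "z \<notin> A" for z
    using no found[OF z] by blast
  have mA: "finite A" "card A = k" using A \<G>_sub memD by auto
  have "{B \<in> \<G>. A - {y} \<subseteq> B} \<subseteq> (\<lambda>z. insert z (A - {y})) ` (Z \<union> A)"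
  proof
    fix B assume B: "B \<in> {B \<in> \<G>. A - {y} \<subseteq> B}"
    then have mB: "finite B" "card B = k" using \<G>_sub memD by auto
    have "card (B - (A - {y})) = 1"
      using B mA mB A k_ge_3 by (subst card_Diff_subset) auto
    then obtain z where "B - (A - {y}) = {z}" by (auto simp: card_1_singleton_iff)
    then have "B = insert z (A - {y})" using B by blast
    then show "B \<in> (\<lambda>z. insert z (A - {y})) ` (Z \<union> A)" using none B by blast
  qed
  then have "card {B \<in> \<G>. A - {y} \<subseteq> B} \<le> card (Z \<union> A)"
    using Z mA by (meson card_image_le card_mono finite_UnI finite_imageI le_trans)
  also have "\<dots> \<le> 3 * k" using card_Un_le[of Z A] Z mA by simp
  finally show False using many_swaps[OF A] by simp
qed

text \<open>The many core members above \<open>A - {y}\<close> prevent it from being own. Since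
  \<open>C\<close> may be any member, the core also controls sets outside it.\<close>

lemma inter_not_swappable:
  assumes "A \<in> \<G>" "y \<in> A" "y \<noteq> ctr A" "C \<in> \<F>"
  shows "A \<inter> C \<noteq> {y}"
proof -
  have "\<not> own A y"
  proof
    assume "own A y"
    then have "{B \<in> \<G>. A - {y} \<subseteq> B} \<subseteq> {A}" using \<G>_sub unfolding own_def by blast
    then have "card {B \<in> \<G>. A - {y} \<subseteq> B} \<le> 1" using card_mono[of "{A}"] by fastforce
    then show False using many_swaps[OF assms(1-3)] k_ge_3 by simp
  qed
  then show ?thesis using not_own_inter assms \<G>_sub by blast
qed

text \<open>If \<open>ctr A \<notin> B\<close>, exchange elements of \<open>A \<inter> B\<close> out of \<open>B\<close> until a single one is left.\<close>

lemma ctr_in_other: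
  assumes "A \<in> \<G>" "B \<in> \<G>" "A \<inter> B \<noteq> {}"
  shows "ctr A \<in> B"
  using assms(2,3)
proof (induction "card (A \<inter> B)" arbitrary: B rule: less_induct)
  case less
  have fin: "finite A" "card A = k" "finite B" using assms(1) less.prems \<G>_sub memD by auto
  show ?case
  proof (rule ccontr)
    assume nin: "ctr A \<notin> B"
    have "card (A \<inter> B) \<noteq> 0" using less.prems fin by simp
    moreover have "card (A \<inter> B) \<noteq> 1"
    proof
      assume "card (A \<inter> B) = 1"
      then obtain y where "A \<inter> B = {y}" by (auto simp: card_1_singleton_iff)
      then show False
        using inter_not_swappable[of A y B] assms(1) nin less.prems \<G>_sub by blast
    qed
    ultimately have two: "2 \<le> card (A \<inter> B)" by simp
    \<comment> \<open>One of the two or more common points is not \<open>ctr B\<close>. Exchanging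
      it for a point outside \<open>A\<close> shrinks the intersection by exactly that point and
      cannot bring in \<open>ctr A\<close>.\<close>
    have "\<not> A \<inter> B \<subseteq> {ctr B}"
    proof
      assume "A \<inter> B \<subseteq> {ctr B}"
      then have "card (A \<inter> B) \<le> 1" using card_mono[of "{ctr B}"] by fastforce
      then show False using two by simp
    qed
    then obtain t where t: "t \<in> A" "t \<in> B" "t \<noteq> ctr B" by blast
    obtain z where z: "z \<notin> A" "insert z (B - {t}) \<in> \<G>"
      using swap[of B t A] t less.prems fin by auto
    have int: "A \<inter> insert z (B - {t}) = A \<inter> B - {t}" using z by blast
    have "card (A \<inter> B - {t}) < card (A \<inter> B)" using t fin by (intro psubset_card_mono) auto
    moreover have "A \<inter> B - {t} \<noteq> {}"
    proof
      assume "A \<inter> B - {t} = {}"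
      then have "card (A \<inter> B) \<le> card {t}" by (intro card_mono) auto
      then show False using two by simp
    qed
    ultimately have "ctr A \<in> insert z (B - {t})"
      using less.hyps[of "insert z (B - {t})"] int z by simp
    then show False using nin z ctr_in[OF assms(1)] by auto
  qed
qed

text \<open>Both centres lie in both sets. If they differ, \<open>ctr A\<close> can be exchanged out
  of \<open>B\<close> while \<open>ctr B\<close> stays common to both, and
  \<open>ctr_in_other\<close> would force \<open>ctr A\<close> back in.\<close>

lemma ctr_eq:
  assumes A: "A \<in> \<G>" and B: "B \<in> \<G>" and "A \<inter> B \<noteq> {}"
  shows "ctr A = ctr B"
proof (rule ccontr)
  assume ne: "ctr A \<noteq> ctr B"
  have "ctr A \<in> B" "ctr B \<in> A"
    using ctr_in_other[of A B] ctr_in_other[of B A] assms by blast+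
  moreover have "finite A" "card A = k" using A \<G>_sub memD by auto
  ultimately obtain z where z: "z \<notin> A" "insert z (B - {ctr A}) \<in> \<G>"
    using swap[of B "ctr A" A] B ne by auto
  have "ctr B \<in> A \<inter> insert z (B - {ctr A})" using \<open>ctr B \<in> A\<close> ctr_in[OF B] ne by simp
  then have "ctr A \<in> insert z (B - {ctr A})" using ctr_in_other[OF A z(2)] by blast
  then show False using z ctr_in[OF A] by auto
qed

section \<open>Supports of the centres\<close>

definition support :: "'a \<Rightarrow> 'a set" where
  "support x = \<Union>{A \<in> \<G>. ctr A = x}"

lemma support_sub: "support x \<subseteq> X"
proof -
  have "A \<subseteq> X" if "A \<in> \<G>" for A using that \<G>_sub memD(1) by blast
  then show ?thesis unfolding support_def by blast
qed

lemma finite_support: "finite (support x)"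
  using support_sub finite_X finite_subset by blast

lemma support_disjoint: "x \<noteq> y \<Longrightarrow> support x \<inter> support y = {}"
proof (rule ccontr)
  assume "x \<noteq> y" "support x \<inter> support y \<noteq> {}"
  then obtain A B where "A \<in> \<G>" "B \<in> \<G>" "ctr A = x" "ctr B = y" "A \<inter> B \<noteq> {}"
    unfolding support_def by blast
  then show False using ctr_eq[of A B] \<open>x \<noteq> y\<close> by simp
qed

lemma card_fibre_le: "fact (k - 1) * card {A \<in> \<G>. ctr A = x} \<le> card (support x) ^ (k - 1)"
proof -
  have "card {A \<in> \<G>. ctr A = x} \<le> card (nsets (support x) (k - 1))"
  proof (rule card_inj_on_le)
    show "inj_on (\<lambda>A. A - {x}) {A \<in> \<G>. ctr A = x}"
    proof (rule inj_onI)
      fix A B assume *: "A \<in> {A \<in> \<G>. ctr A = x}" "B \<in> {A \<in> \<G>. ctr A = x}" "A - {x} = B - {x}"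
      then have "x \<in> A" "x \<in> B" using ctr_in[of A] ctr_in[of B] by auto
      then show "A = B" using *(3) by blast
    qed
    have "A - {x} \<in> nsets (support x) (k - 1)" if A: "A \<in> \<G>" "ctr A = x" for A
    proof -
      have "finite A" "card A = k" using A \<G>_sub memD by auto
      moreover have "x \<in> A" using A ctr_in[of A] by simp
      moreover have "A \<subseteq> support x" using A by (auto simp: support_def)
      ultimately show ?thesis by (auto simp: nsets_def)
    qed
    then show "(\<lambda>A. A - {x}) ` {A \<in> \<G>. ctr A = x} \<subseteq> nsets (support x) (k - 1)" by blast
    show "finite (nsets (support x) (k - 1))" by (rule finite_imp_finite_nsets[OF finite_support])
  qed
  then have "fact (k - 1) * card {A \<in> \<G>. ctr A = x} \<le> (card (support x) choose (k - 1)) * fact (k - 1)"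
    by (simp add: mult.commute)
  also have "\<dots> \<le> card (support x) ^ (k - 1)" by (rule binomial_fact_pow)
  finally show ?thesis .
qed

text \<open>With \<open>v\<close> the largest support size, each fibre contributes at most its
  support size times \<open>v * n ^ (k - 3)\<close>. The supports are disjoint, so their sizes sum
  to at most \<open>n\<close>, and dividing by \<open>n ^ (k - 2)\<close> leaves
  \<open>n \<le> v + c\<close>.\<close>

lemma large_support:
  assumes large: "card X ^ (k - 1) \<le> fact (k - 1) * card \<G> + c * card X ^ (k - 2)"
    and ne: "X \<noteq> {}"
  shows "\<exists>x. card X \<le> card (support x) + c"
proof -
  define n where "n = card X"
  define I where "I = ctr ` \<G>"
  have n0: "n > 0" using ne finite_X by (simp add: n_def card_gt_0_iff)
  have fin\<G>: "finite \<G>" using \<G>_sub finite_\<F> finite_subset by blast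
  then have finI: "finite I" by (simp add: I_def)
  \<comment> \<open>The inserted 0 covers an empty core; if \<open>v\<close> is 0, the final
    inequality reads \<open>n \<le> c\<close> and any \<open>x\<close> will do.\<close>
  define v where "v = Max (insert 0 ((\<lambda>x. card (support x)) ` I))"
  have v_ge: "card (support x) \<le> v" if "x \<in> I" for x
    unfolding v_def using finI that by (intro Max_ge) auto
  have v_in: "v \<in> insert 0 ((\<lambda>x. card (support x)) ` I)"
    unfolding v_def using finI by (intro Max_in) auto
  have s_le: "card (support x) \<le> n" for x
    unfolding n_def by (rule card_mono[OF finite_X support_sub])
  have "card \<G> = (\<Sum>x\<in>I. card {A \<in> \<G>. ctr A = x})"
    unfolding I_def card_eq_sum[of \<G>] by (subst sum.image_gen[OF fin\<G>, of _ ctr]) simp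
  then have "fact (k - 1) * card \<G> = (\<Sum>x\<in>I. fact (k - 1) * card {A \<in> \<G>. ctr A = x})"
    by (simp add: sum_distrib_left)
  also have "\<dots> \<le> (\<Sum>x\<in>I. card (support x) * (v * n ^ (k - 3)))"
  proof (rule sum_mono)
    fix x assume x: "x \<in> I"
    have "fact (k - 1) * card {A \<in> \<G>. ctr A = x} \<le> card (support x) ^ (k - 1)"
      by (rule card_fibre_le)
    also have "\<dots> = card (support x) ^ Suc (Suc (k - 3))"
      using k_ge_3 by (intro arg_cong[where f = "\<lambda>i. card (support x) ^ i"]) simp
    also have "\<dots> = card (support x) * (card (support x) * card (support x) ^ (k - 3))" by simp
    also have "\<dots> \<le> card (support x) * (v * n ^ (k - 3))"
      using v_ge[OF x] s_le by (intro mult_mono power_mono) auto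
    finally show "fact (k - 1) * card {A \<in> \<G>. ctr A = x} \<le> card (support x) * (v * n ^ (k - 3))" .
  qed
  also have "\<dots> = card (\<Union>x\<in>I. support x) * (v * n ^ (k - 3))"
    unfolding sum_distrib_right[symmetric]
    by (subst card_UN_disjoint) (use finI finite_support support_disjoint in auto)
  also have "\<dots> \<le> n * (v * n ^ (k - 3))"
    unfolding n_def using support_sub finite_X by (intro mult_right_mono card_mono) auto
  also have "\<dots> = v * n ^ Suc (k - 3)" by simp
  also have "Suc (k - 3) = k - 2" using k_ge_3 by simp
  finally have "n ^ (k - 1) \<le> (v + c) * n ^ (k - 2)"
    using large by (simp add: n_def algebra_simps)
  moreover have "n ^ (k - 1) = n * n ^ (k - 2)"
    using k_ge_3 by (metis Suc_diff_Suc Suc_1 Suc_le_lessD numeral_3_eq_3 One_nat_def Suc_lessD power_Suc)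
  ultimately have "n \<le> v + c" using n0 by simp
  then show ?thesis using v_in by (fastforce simp: n_def)
qed

text \<open>If a core set \<open>A\<close> with centre \<open>x\<close> met \<open>B\<close>, all
  its points in \<open>B\<close> could be exchanged, giving a core set \<open>C\<close> disjoint
  from \<open>B\<close> with \<open>A - B \<subseteq> C\<close>. Then \<open>A\<close>,
  \<open>B\<close>, \<open>C\<close> form a cluster with union \<open>B \<union> C\<close>.\<close>

lemma disjoint_from_core:
  assumes B: "B \<in> \<F>" "x \<notin> B"
  shows "B \<inter> support x = {}"
proof (rule ccontr)
  assume "B \<inter> support x \<noteq> {}"
  then obtain A where A: "A \<in> \<G>" "ctr A = x" "A \<inter> B \<noteq> {}" by (auto simp: support_def)
  have mB: "finite B" "card B = k" using B memD by auto
  \<comment> \<open>The exchanged points lie in \<open>B\<close>, hence differ from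
    \<open>x\<close>. Consecutive sets share \<open>x\<close>, so \<open>ctr_eq\<close> keeps the
    centre fixed.\<close>
  have step: "\<exists>C'\<in>\<G>. ctr C' = x \<and> A - B \<subseteq> C' \<and> C' \<inter> B = {}"
    if "C \<in> \<G>" "ctr C = x" "A - B \<subseteq> C" for C
    using that
  proof (induction "card (C \<inter> B)" arbitrary: C rule: less_induct)
    case less
    show ?case
    proof (cases "C \<inter> B = {}")
      case False
      then obtain t where t: "t \<in> C" "t \<in> B" by blast
      have tx: "t \<noteq> ctr C" using t B less.prems by auto
      obtain z where z: "z \<notin> B" "insert z (C - {t}) \<in> \<G>"
        using swap[OF less.prems(1) t(1) tx mB(1)] mB by auto
      have "x \<in> C" using ctr_in less.prems by blast
      then have "C \<inter> insert z (C - {t}) \<noteq> {}" using tx less.prems by blast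
      then have "ctr (insert z (C - {t})) = x"
        using ctr_eq[OF less.prems(1) z(2)] less.prems by simp
      moreover have "card (insert z (C - {t}) \<inter> B) < card (C \<inter> B)"
        using t z mB by (intro psubset_card_mono) auto
      moreover have "A - B \<subseteq> insert z (C - {t})" using less.prems t by blast
      ultimately show ?thesis using less.hyps z by blast
    qed (use less.prems in blast)
  qed
  obtain C where C: "C \<in> \<G>" "A - B \<subseteq> C" "C \<inter> B = {}" using step[of A] A by blast
  have in\<F>: "A \<in> \<F>" "C \<in> \<F>" using A C \<G>_sub by auto
  have "x \<in> A" using ctr_in A by blast
  have "B \<noteq> {}" using mB k_ge_3 by auto
  then have "2 * k < card (A \<union> B \<union> C)"
    using in\<F> B C A \<open>x \<in> A\<close> by (intro no_cluster) auto
  moreover have "A \<union> B \<union> C = B \<union> C" using C by blast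
  moreover have "card (B \<union> C) \<le> 2 * k" using card_Un_le[of B C] mB memD in\<F> by simp
  ultimately show False by simp
qed

end

section \<open>Construction of the core\<close>

context three_cluster_free
begin

text \<open>Comparing \<open>card_shadow\<close> with the size of the family bounds
  \<open>card F2 + card D\<close> by \<open>e * N\<close>: the \<open>a\<close> in \<open>e\<close>
  is the assumed deficit, and \<open>2 * k ^ 2\<close> comes from \<open>F0\<close>. Besides
  \<open>F0\<close> and \<open>F2\<close>, only the members peeled off \<open>F1\<close>, at most
  \<open>3 * k\<close> per set in \<open>D\<close>, are lost.\<close>

lemma swappable_core_exists:
  fixes a :: nat
  assumes large: "card X choose (k - 1) \<le> card \<F> + a * card X ^ (k - 2)"
  defines "e \<equiv> a + 2 * k ^ 2"
  shows "\<exists>\<G> ctr. swappable_core X k \<F> \<G> ctr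
    \<and> card \<F> \<le> card \<G> + (2 * k ^ 2 + e + 3 * k * e) * card X ^ (k - 2)"
proof -
  define N where "N = card X ^ (k - 2)"
  define F0 where "F0 = {A \<in> \<F>. \<forall>y\<in>A. \<not> own A y}"
  define F1 where "F1 = {A \<in> \<F>. \<exists>!y. y \<in> A \<and> own A y}"
  define F2 where "F2 = {A \<in> \<F>. (\<exists>y\<in>A. own A y) \<and> \<not> (\<exists>!y. y \<in> A \<and> own A y)}"
  define D where "D = {S \<in> nsets X (k - 1). 2 \<le> card {A \<in> \<F>. S \<subseteq> A}}"
  have fin: "finite F0" "finite F1" "finite F2" using finite_\<F> by (auto simp: F0_def F1_def F2_def)
  have "card \<F> \<le> card (F0 \<union> F1 \<union> F2)"
    by (rule card_mono) (use fin in \<open>auto simp: F0_def F1_def F2_def\<close>)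
  also have "\<dots> \<le> card F0 + card F1 + card F2"
    by (meson add_le_mono1 card_Un_le le_trans)
  finally have split: "card \<F> \<le> card F0 + card F1 + card F2" .
  have F0: "card F0 \<le> 2 * k ^ 2 * N" using card_no_own by (simp add: F0_def N_def)
  have "card F1 + 2 * card F2 + card D \<le> card X choose (k - 1)"
    unfolding F1_def F2_def D_def by (rule card_shadow)
  then have F2D: "card F2 + card D \<le> e * N"
    using large split F0 by (simp add: e_def N_def algebra_simps)
  have "finite D" unfolding D_def using finite_imp_finite_nsets[OF finite_X] by simp
  then obtain \<G> where \<G>: "\<G> \<subseteq> F1" "card (F1 - \<G>) \<le> 3 * k * card D"
    "\<forall>S\<in>D. (\<exists>A\<in>\<G>. S \<subseteq> A) \<longrightarrow> 3 * k < card {A \<in> \<G>. S \<subseteq> A}"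
    using peeling[of D F1 "3 * k"] fin by blast
  define ctr where "ctr A = (THE y. y \<in> A \<and> own A y)" for A
  have ctr: "ctr A \<in> A" "\<And>y. y \<in> A \<Longrightarrow> own A y \<Longrightarrow> y = ctr A" if "A \<in> F1" for A
  proof -
    have ex1: "\<exists>!y. y \<in> A \<and> own A y" using that by (simp add: F1_def)
    show "ctr A \<in> A" using theI'[OF ex1] by (simp add: ctr_def)
    show "y = ctr A" if "y \<in> A" "own A y" for y
      using the1_equality[OF ex1, of y] that by (simp add: ctr_def)
  qed
  have "swappable_core X k \<F> \<G> ctr"
  proof
    show "\<G> \<subseteq> \<F>" using \<G>(1) by (auto simp: F1_def)
    fix A assume A: "A \<in> \<G>"
    show "ctr A \<in> A" using ctr A \<G>(1) by blast
    fix y assume y: "y \<in> A" "y \<noteq> ctr A"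
    have A1: "A \<in> F1" using A \<G>(1) by blast
    then have A\<F>: "A \<in> \<F>" by (simp add: F1_def)
    have "\<not> own A y" using ctr(2)[OF A1] y by blast
    then obtain B where B: "B \<in> \<F>" "A - {y} \<subseteq> B" "B \<noteq> A"
      using A\<F> unfolding own_def by blast
    have "card {A, B} \<le> card {C \<in> \<F>. A - {y} \<subseteq> C}"
      using finite_\<F> A\<F> B by (intro card_mono) auto
    then have "A - {y} \<in> D" using B(3) memD[OF A\<F>] y by (auto simp: D_def nsets_def)
    then show "3 * k < card {B \<in> \<G>. A - {y} \<subseteq> B}" using \<G>(3) A by blast
  qed
  moreover have "card \<F> \<le> card \<G> + (2 * k ^ 2 + e + 3 * k * e) * N"
  proof -
    have "card F1 \<le> card \<G> + card (F1 - \<G>)"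
      using \<G>(1) fin by (metis card_Diff_subset card_mono finite_subset le_add_diff_inverse order_refl)
    moreover have "3 * k * card D \<le> 3 * k * (e * N)" using F2D by (intro mult_left_mono) auto
    ultimately have "card \<F> \<le> card \<G> + 2 * k ^ 2 * N + e * N + 3 * k * (e * N)"
      using split F0 F2D \<G>(2) by linarith
    then show ?thesis by (simp add: algebra_simps)
  qed
  ultimately show ?thesis unfolding N_def by blast
qed

end

section \<open>Families close to a star\<close>

text \<open>Bounds the number of vertices outside the large support. One \<open>k + 1\<close> pays
  for passing from \<open>card X - k - 1\<close> to \<open>card X\<close>, the bracket after it is
  the loss in \<open>swappable_core_exists\<close> with \<open>a = k + 1\<close>, and
  \<open>(k - 1) ^ 2\<close> is the error in \<open>power_le_fact_binomial\<close>.\<close>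

definition core_deficit :: "nat \<Rightarrow> nat" where
  "core_deficit k = (let e = k + 1 + 2 * k ^ 2 in
     fact (k - 1) * (k + 1 + (2 * k ^ 2 + e + 3 * k * e)) + (k - 1) ^ 2)"

context three_cluster_free
begin

text \<open>The set \<open>insert x Q\<close> is disjoint from \<open>B\<close>, and together they
  cover \<open>A\<close>. So the three sets would form a cluster with union of size at most
  \<open>2 * k\<close>.\<close>

lemma kills_supersets:
  assumes A: "A \<in> \<F>" "x \<in> A" and B: "B \<in> \<F>" "x \<notin> B" and AB: "A \<inter> B \<noteq> {}"
    and Q: "Q \<in> nsets (X - B - {x}) (k - 1)" "A - B - {x} \<subseteq> Q"
  shows "insert x Q \<notin> \<F>"
proof
  assume C: "insert x Q \<in> \<F>"
  have QB: "Q \<inter> B = {}" using Q by (auto simp: nsets_def)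
  have "B \<noteq> {}" using memD(3)[OF B(1)] k_ge_3 by auto
  then have "2 * k < card (A \<union> B \<union> insert x Q)"
    using A B C QB AB by (intro no_cluster) auto
  moreover have "A \<union> B \<union> insert x Q = B \<union> insert x Q" using Q A by blast
  moreover have "card (B \<union> insert x Q) \<le> 2 * k"
    using card_Un_le[of B "insert x Q"] memD(3)[OF B(1)] memD(3)[OF C] by simp
  ultimately show False by simp
qed

text \<open>Besides \<open>x\<close>, a point of \<open>A \<inter> B\<close> is lost. This leaves a
  free point in every \<open>(k - 1)\<close>-set above the trace, hence linearly many such
  sets.\<close>

lemma card_trace_le:
  assumes "A \<in> \<F>" "x \<in> A" "x \<notin> B" "A \<inter> B \<noteq> {}"
  shows "card (A - B - {x}) \<le> k - 2"
proof -
  obtain y where y: "y \<in> A" "y \<in> B" using assms by blast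
  then have "card (A - B - {x}) \<le> card (A - {x, y})"
    using memD[OF assms(1)] by (intro card_mono) auto
  also have "\<dots> = k - 2"
  proof -
    have "x \<noteq> y" using assms(3) y(2) by blast
    then show ?thesis using memD[OF assms(1)] assms(2) y(1) by (simp add: card_Diff_subset)
  qed
  finally show ?thesis .
qed

text \<open>\<open>M\<close> records the sets missing from the full star at \<open>x\<close> outside
  \<open>B\<close>. Members through \<open>x\<close> meeting \<open>B\<close> force at least twice
  as many missing sets, and a second member avoiding \<open>x\<close> makes \<open>M\<close> larger
  than \<open>2 * b\<close>.\<close>

lemma near_star_bound:
  assumes x: "x \<in> X" and B: "B \<in> \<F>" "x \<notin> B" and b: "card {B \<in> \<F>. x \<notin> B} \<le> b"
    and large: "3 * k + 2 * 2 ^ (2 * k) + 2 * b + 1 \<le> card X"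
  defines "c \<equiv> (card X - k - 1) choose (k - 1)"
  shows "card \<F> \<le> c + 1 \<and> (card \<F> = c + 1 \<longrightarrow> \<F> = {B} \<union> {A \<in> [X - B]\<^bsup>k\<^esup>. x \<in> A})"
proof -
  define \<B> where "\<B> = {B \<in> \<F>. x \<notin> B}"
  define Y where "Y = X - B - {x}"
  define M where "M = {Q \<in> nsets Y (k - 1). insert x Q \<notin> \<F>}"
  define S0 where "S0 = {A \<in> \<F>. x \<in> A \<and> A \<inter> B = {}}"
  define S1 where "S1 = {A \<in> \<F>. x \<in> A \<and> A \<inter> B \<noteq> {}}"
  define P where "P = (\<lambda>A. A - B - {x}) ` S1"
  have mB: "B \<subseteq> X" "finite B" "card B = k" using memD B by auto
  have finY: "finite Y" and cY: "card Y = card X - k - 1"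
    using finite_X mB B x by (auto simp: Y_def card_Diff_subset)
  have finQ: "finite (nsets Y (k - 1))" by (rule finite_imp_finite_nsets[OF finY])
  have finM: "finite M" using finQ by (simp add: M_def)
  have finS: "finite S0" "finite S1" "finite \<B>" using finite_\<F> by (auto simp: S0_def S1_def \<B>_def)
  have k1: "k - 1 = Suc (k - 2)" using k_ge_3 by simp
  have remove_x: "A - {x} \<in> nsets Y (k - 1)" if "A \<in> S0" for A
  proof -
    have "A \<in> \<F>" "x \<in> A" "A \<inter> B = {}" using that by (auto simp: S0_def)
    then show ?thesis using memD[of A] by (auto simp: nsets_def Y_def)
  qed
  have S0_M: "card S0 + card M \<le> c"
  proof -
    have "card S0 \<le> card (nsets Y (k - 1) - M)"
    proof (rule card_inj_on_le)
      show "inj_on (\<lambda>A. A - {x}) S0" unfolding S0_def by (rule inj_onI) blast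
      show "(\<lambda>A. A - {x}) ` S0 \<subseteq> nsets Y (k - 1) - M"
        using remove_x by (auto simp: M_def S0_def insert_absorb)
      show "finite (nsets Y (k - 1) - M)" using finQ by simp
    qed
    also have "\<dots> = card (nsets Y (k - 1)) - card M"
      by (rule card_Diff_subset) (use finM in \<open>auto simp: M_def\<close>)
    finally have "card S0 \<le> c - card M" by (simp add: c_def cY)
    moreover have "card M \<le> card (nsets Y (k - 1))" by (rule card_mono[OF finQ]) (auto simp: M_def)
    ultimately show ?thesis by (simp add: c_def cY)
  qed
  \<comment> \<open>A member of \<open>S1\<close> is recovered from its trace outside
    \<open>B\<close> and its intersection with \<open>B\<close>.\<close>
  have S1_P: "card S1 \<le> card P * 2 ^ k"
  proof -
    have "card S1 \<le> card (P \<times> Pow B)"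
    proof (rule card_inj_on_le)
      show "inj_on (\<lambda>A. (A - B - {x}, A \<inter> B)) S1" unfolding S1_def by (rule inj_onI) blast
      show "(\<lambda>A. (A - B - {x}, A \<inter> B)) ` S1 \<subseteq> P \<times> Pow B" by (auto simp: P_def)
      show "finite (P \<times> Pow B)" using finS mB by (simp add: P_def)
    qed
    then show ?thesis using mB by (simp add: card_cartesian_product card_Pow)
  qed
  \<comment> \<open>Count pairs of a trace and a missing set above it: each trace excludes all its
    supersets by \<open>kills_supersets\<close>, and a missing set has at most \<open>2 ^ k\<close>
    subsets.\<close>
  have P_M: "(card X - 2 * k) * card P \<le> 2 ^ k * card M"
  proof (rule double_count_le[where R = "\<lambda>p Q. p \<subseteq> Q"])
    show "finite P" using finS by (simp add: P_def)
    show "finite M" by (rule finM)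
    fix p assume "p \<in> P"
    then obtain A where A: "A \<in> \<F>" "x \<in> A" "A \<inter> B \<noteq> {}" "p = A - B - {x}"
      by (auto simp: P_def S1_def)
    have "p \<subseteq> Y" "card p \<le> k - 2"
      using A memD(1)[OF A(1)] card_trace_le[of A x B] B by (auto simp: Y_def)
    then have "card Y - (k - 2) \<le> card {Q \<in> nsets Y (Suc (k - 2)). p \<subseteq> Q}"
      by (intro card_supersets_ge finY)
    also have "\<dots> \<le> card {Q \<in> M. p \<subseteq> Q}"
    proof (rule card_mono)
      show "{Q \<in> nsets Y (Suc (k - 2)). p \<subseteq> Q} \<subseteq> {Q \<in> M. p \<subseteq> Q}"
        using kills_supersets[OF A(1,2) B A(3)] A(4) unfolding M_def Y_def k1 by blast
    qed (use finM in simp)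
    finally show "card X - 2 * k \<le> card {Q \<in> M. p \<subseteq> Q}" using cY k_ge_3 by simp
  next
    fix Q assume "Q \<in> M"
    then have Q: "finite Q" "card Q = k - 1" by (auto simp: M_def nsets_def)
    then have "card {p \<in> P. p \<subseteq> Q} \<le> card (Pow Q)" by (intro card_mono) auto
    also have "\<dots> \<le> 2 ^ k" using Q by (simp add: card_Pow)
    finally show "card {p \<in> P. p \<subseteq> Q} \<le> 2 ^ k" .
  qed
  \<comment> \<open>The two factors \<open>2 ^ k\<close> combine to \<open>2 ^ (2 * k)\<close>; the
    assumed size of \<open>X\<close> beats this by a further factor of two.\<close>
  have S1_M: "2 * card S1 \<le> card M"
  proof -
    have "(2 * 2 ^ (2 * k)) * card S1 \<le> (card X - 2 * k) * (card P * 2 ^ k)"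
      using large S1_P by (intro mult_mono) auto
    also have "\<dots> \<le> 2 ^ k * (2 ^ k * card M)"
      using mult_le_mono1[OF P_M, of "2 ^ k"] by (simp add: mult_ac)
    also have "\<dots> = 2 ^ (2 * k) * card M" by (simp add: mult_2 power_add)
    finally have "2 ^ (2 * k) * (2 * card S1) \<le> 2 ^ (2 * k) * card M" by (simp add: mult_ac)
    then show ?thesis by simp
  qed
  have split: "card \<F> = card S0 + card S1 + card \<B>"
  proof -
    have "\<F> = S0 \<union> S1 \<union> \<B>" by (auto simp: S0_def S1_def \<B>_def)
    moreover have "card (S0 \<union> S1 \<union> \<B>) = card (S0 \<union> S1) + card \<B>"
      by (rule card_Un_disjoint) (use finS in \<open>auto simp: S0_def S1_def \<B>_def\<close>)
    moreover have "card (S0 \<union> S1) = card S0 + card S1"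
      by (rule card_Un_disjoint) (use finS in \<open>auto simp: S0_def S1_def\<close>)
    ultimately show ?thesis by simp
  qed
  show ?thesis
  proof (cases "\<B> = {B}")
    case True
    then have bound: "card \<F> \<le> c + 1" using split S0_M S1_M by simp
    moreover have "\<F> = {B} \<union> {A \<in> [X - B]\<^bsup>k\<^esup>. x \<in> A}" if eq: "card \<F> = c + 1"
    proof -
      \<comment> \<open>Equality gives \<open>card M \<le> card S1\<close>, while
        \<open>2 * card S1 \<le> card M\<close>, so both vanish.\<close>
      have "card M = 0" "card S1 = 0" using eq True split S0_M S1_M by auto
      then have empty: "M = {}" "S1 = {}" using finM finS by auto
      have "A \<in> \<F>" if A: "A \<in> [X - B]\<^bsup>k\<^esup>" "x \<in> A" for A
      proof -
        have "A - {x} \<in> nsets Y (k - 1)" using A by (auto simp: nsets_def Y_def)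
        then have "insert x (A - {x}) \<in> \<F>" using empty by (auto simp: M_def)
        then show ?thesis using A by (simp add: insert_absorb)
      qed
      moreover have "A = B \<or> A \<in> [X - B]\<^bsup>k\<^esup> \<and> x \<in> A" if A: "A \<in> \<F>" for A
      proof (cases "x \<in> A")
        case True
        then have "A \<inter> B = {}" using A empty by (auto simp: S1_def)
        then show ?thesis using True memD[OF A] by (auto simp: nsets_def)
      next
        case False
        then show ?thesis using A True by (auto simp: \<B>_def)
      qed
      ultimately show ?thesis using B by blast
    qed
    ultimately show ?thesis by blast
  next
    case False
    moreover have "B \<in> \<B>" using B by (simp add: \<B>_def)
    ultimately obtain B1 where B1: "B1 \<in> \<F>" "x \<notin> B1" "B1 \<noteq> B" unfolding \<B>_def by blast
    have mB1: "finite B1" "card B1 = k" "B1 \<subseteq> X" using memD B1 by auto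
    have "\<not> B1 \<subseteq> B" using B1(3) mB mB1 card_subset_eq by metis
    then obtain y where y: "y \<in> B1" "y \<notin> B" by blast
    have yY: "y \<in> Y" using y mB1 B1 by (auto simp: Y_def)
    \<comment> \<open>Either a star member through \<open>y\<close> is present, and then it meets
      \<open>B1\<close> and excludes many sets with \<open>B1\<close> in the role of
      \<open>B\<close>; or all \<open>(k - 1)\<close>-subsets of \<open>Y\<close> through
      \<open>y\<close> are missing. Working in \<open>Y - B1\<close> ensures that the excluded sets
      also count towards \<open>M\<close>.\<close>
    have many: "card X - 3 * k \<le> card M"
    proof (cases "\<exists>Q\<in>nsets Y (k - 1). y \<in> Q \<and> insert x Q \<in> \<F>")
      case True
      then obtain Q where Q: "Q \<in> nsets Y (k - 1)" "y \<in> Q" "insert x Q \<in> \<F>" by blast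
      define p where "p = insert x Q - B1 - {x}"
      have p: "p \<subseteq> Y - B1" using Q by (auto simp: p_def nsets_def)
      have "card p \<le> k - 2"
        unfolding p_def using Q B1 y by (intro card_trace_le) auto
      then have "card (Y - B1) - (k - 2) \<le> card {R \<in> nsets (Y - B1) (Suc (k - 2)). p \<subseteq> R}"
        using finY by (intro card_supersets_ge p) auto
      also have "\<dots> \<le> card M"
      proof (rule card_mono[OF finM], rule subsetI)
        fix R assume "R \<in> {R \<in> nsets (Y - B1) (Suc (k - 2)). p \<subseteq> R}"
        then have R: "R \<in> nsets (Y - B1) (k - 1)" "p \<subseteq> R" unfolding k1 by auto
        have "R \<in> nsets (X - B1 - {x}) (k - 1)" "R \<in> nsets Y (k - 1)"
          using R(1) by (auto simp: Y_def nsets_def)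
        moreover have "insert x Q \<inter> B1 \<noteq> {}" using Q y by blast
        ultimately show "R \<in> M"
          using kills_supersets[OF Q(3) _ B1(1,2)] R(2) by (auto simp: M_def p_def)
      qed
      moreover have "card Y - k \<le> card (Y - B1)"
        using diff_card_le_card_Diff[OF mB1(1), of Y] mB1(2) by simp
      ultimately show ?thesis using cY k_ge_3 by simp
    next
      case False
      have "card Y - (k - 2) \<le> card {Q \<in> nsets Y (Suc (k - 2)). {y} \<subseteq> Q}"
        using yY finY k_ge_3 by (intro card_supersets_ge) auto
      also have "\<dots> \<le> card M"
        using False unfolding k1[symmetric] M_def
        by (intro card_mono finM[unfolded M_def]) auto
      finally show ?thesis using cY k_ge_3 by simp
    qed
    have "card \<F> < c"
      using split S0_M S1_M many b large unfolding \<B>_def by linarith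
    then show ?thesis by simp
  qed
qed

text \<open>The core is large enough for one support to miss at most \<open>core_deficit k\<close>
  vertices. By \<open>disjoint_from_core\<close>, members avoiding its centre are subsets of the
  complement, which yields the power of two.\<close>

lemma near_star_exists:
  assumes X_large: "core_deficit k < card X"
    and large: "(card X - k - 1) choose (k - 1) \<le> card \<F>"
  shows "\<exists>x\<in>X. card {B \<in> \<F>. x \<notin> B} \<le> 2 ^ core_deficit k"
proof -
  define e where "e = k + 1 + 2 * k ^ 2"
  define c where "c = core_deficit k"
  define N where "N = card X ^ (k - 2)"
  define d where "d = 2 * k ^ 2 + e + 3 * k * e"
  have k2: "k - 1 - 1 = k - 2" by simp
  have full: "card X choose (k - 1) \<le> card \<F> + (k + 1) * N"
  proof -
    have "card X choose (k - 1) \<le> ((card X - (k + 1)) choose (k - 1)) + (k + 1) * N"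
      using binomial_le_binomial_diff[of "k - 1" "card X" "k + 1"] k_ge_3 unfolding N_def k2 by linarith
    then show ?thesis using large by simp
  qed
  obtain \<G> ctr where core: "swappable_core X k \<F> \<G> ctr" and card_\<G>: "card \<F> \<le> card \<G> + d * N"
    using swappable_core_exists[of "k + 1"] full unfolding N_def d_def e_def by blast
  interpret swappable_core X k \<F> \<G> ctr by (rule core)
  have "card X ^ (k - 1) \<le> fact (k - 1) * (card X choose (k - 1)) + (k - 1) ^ 2 * N"
    using power_le_fact_binomial[of "card X" "k - 1"] unfolding N_def k2 .
  also have "\<dots> \<le> fact (k - 1) * (card \<G> + d * N + (k + 1) * N) + (k - 1) ^ 2 * N"
    using full card_\<G> by (intro add_right_mono mult_left_mono) auto
  also have "\<dots> = fact (k - 1) * card \<G> + c * N"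
    unfolding c_def core_deficit_def Let_def e_def[symmetric] d_def[symmetric] by (simp add: algebra_simps)
  finally obtain x where x: "card X \<le> card (support x) + c"
    using large_support[of c] X_large unfolding N_def by fastforce
  then have "support x \<noteq> {}" using X_large by (auto simp: c_def)
  then have "x \<in> X" using ctr_in support_sub unfolding support_def by blast
  have "{B \<in> \<F>. x \<notin> B} \<subseteq> Pow (X - support x)"
    using disjoint_from_core memD(1) by blast
  then have "card {B \<in> \<F>. x \<notin> B} \<le> card (Pow (X - support x))"
    using finite_X by (intro card_mono) auto
  also have "\<dots> = 2 ^ card (X - support x)" using finite_X by (simp add: card_Pow)
  also have "card (X - support x) \<le> c"
    using x support_sub finite_support by (simp add: card_Diff_subset)
  finally have "card {B \<in> \<F>. x \<notin> B} \<le> 2 ^ c" by simp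
  then show ?thesis using \<open>x \<in> X\<close> unfolding c_def by blast
qed

end

section \<open>The extremal family and the theorem\<close>

text \<open>Excluding the empty set, the only set disjoint from itself, ensures that two disjoint
  members are distinct.\<close>

lemma matching_number_ge_2_iff:
  assumes "finite \<F>" "{} \<notin> \<F>"
  shows "2 \<le> matching_number \<F> \<longleftrightarrow> (\<exists>A\<in>\<F>. \<exists>B\<in>\<F>. A \<inter> B = {})"
proof -
  let ?S = "card ` {\<M>. \<M> \<subseteq> \<F> \<and> disjoint \<M>}"
  have fin: "finite ?S" using assms by simp
  have ne: "?S \<noteq> {}" by (force simp: pairwise_def)
  show ?thesis
  proof
    assume two: "2 \<le> matching_number \<F>"
    have "matching_number \<F> \<in> ?S" unfolding matching_number_def by (rule Max_in[OF fin ne])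
    then obtain \<M> where \<M>: "\<M> \<subseteq> \<F>" "disjoint \<M>" "card \<M> = matching_number \<F>" by auto
    obtain A B where AB: "A \<in> \<M>" "B \<in> \<M>" "A \<noteq> B"
    proof -
      have "\<M> \<noteq> {}" using two \<M> by auto
      then obtain A where A: "A \<in> \<M>" by blast
      have "\<not> \<M> \<subseteq> {A}" using two \<M>(3) card_mono[of "{A}" \<M>] by auto
      then show ?thesis using that A by blast
    qed
    then have "A \<inter> B = {}" using \<M>(2) by (auto simp: pairwise_def disjnt_def)
    then show "\<exists>A\<in>\<F>. \<exists>B\<in>\<F>. A \<inter> B = {}" using AB \<M>(1) by blast
  next
    assume "\<exists>A\<in>\<F>. \<exists>B\<in>\<F>. A \<inter> B = {}"
    then obtain A B where AB: "A \<in> \<F>" "B \<in> \<F>" "A \<inter> B = {}" by blast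
    then have "A \<noteq> B" using assms(2) by auto
    then have "card {A, B} = 2" by simp
    moreover have "{A, B} \<in> {\<M>. \<M> \<subseteq> \<F> \<and> disjoint \<M>}"
      using AB by (auto simp: pairwise_def disjnt_def)
    ultimately have "2 \<in> ?S" by (metis (no_types, lifting) imageI)
    then show "2 \<le> matching_number \<F>" unfolding matching_number_def using fin by (rule Max_ge[rotated])
  qed
qed

context
  fixes X B :: "'a set" and k :: nat and x :: 'a and \<E> :: "'a set set"
  assumes X: "finite X" and B: "B \<in> [X]\<^bsup>k\<^esup>" and x: "x \<in> X - B" and k: "k \<ge> 3"
  defines "\<E> \<equiv> {B} \<union> {F \<in> [X - B]\<^bsup>k\<^esup>. x \<in> F}"
begin

text \<open>Without \<open>B\<close> all sets share \<open>x\<close>, so a cluster contains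
  \<open>B\<close>. The other two are distinct \<open>k\<close>-sets disjoint from \<open>B\<close>,
  so the union has at least \<open>k + (k + 1)\<close> points.\<close>

lemma set_plus_star_cluster_free: "cluster_free k 3 \<E>"
  unfolding cluster_free_def
proof
  assume "\<exists>\<A>\<subseteq>\<E>. is_cluster k 3 \<A>"
  then obtain \<A> where \<A>: "\<A> \<subseteq> \<E>" "finite \<A>" "card \<A> = 3" "card (\<Union>\<A>) \<le> 2 * k" "\<Inter>\<A> = {}"
    unfolding is_cluster_def by blast
  have "B \<in> \<A>"
  proof (rule ccontr)
    assume "B \<notin> \<A>"
    then have "x \<in> \<Inter>\<A>" using \<A>(1) by (auto simp: \<E>_def)
    then show False using \<A>(5) by simp
  qed
  then have "card (\<A> - {B}) = 2" using \<A> by simp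
  then obtain A C where AC: "\<A> - {B} = {A, C}" "A \<noteq> C" by (auto simp: card_2_iff)
  then have in\<E>: "A \<in> [X - B]\<^bsup>k\<^esup>" "C \<in> [X - B]\<^bsup>k\<^esup>" using \<A>(1) by (auto simp: \<E>_def)
  have "A \<subset> A \<union> C"
  proof
    show "A \<noteq> A \<union> C"
    proof
      assume "A = A \<union> C"
      then have "C \<subseteq> A" by blast
      then show False using in\<E> AC(2) card_subset_eq[of A C] by (auto simp: nsets_def)
    qed
  qed simp
  then have "card A < card (A \<union> C)" using in\<E> by (intro psubset_card_mono) (auto simp: nsets_def)
  then have "2 * k < card B + card (A \<union> C)" using in\<E> B by (auto simp: nsets_def)
  also have "card B + card (A \<union> C) = card (B \<union> (A \<union> C))"
    using in\<E> B by (intro card_Un_disjoint[symmetric]) (auto simp: nsets_def)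
  also have "\<dots> \<le> card (\<Union>\<A>)"
  proof (rule card_mono)
    show "finite (\<Union>\<A>)"
      using \<A>(1,2) B by (auto simp: \<E>_def nsets_def)
    show "B \<union> (A \<union> C) \<subseteq> \<Union>\<A>" using \<open>B \<in> \<A>\<close> AC(1) by blast
  qed
  finally show False using \<A>(4) by simp
qed

lemma card_set_plus_star: "card \<E> = ((card X - k - 1) choose (k - 1)) + 1"
proof -
  let ?S = "{F \<in> [X - B]\<^bsup>k\<^esup>. x \<in> F}"
  have finS: "finite ?S" using X finite_imp_finite_nsets[of "X - B" k] by simp
  have "bij_betw (insert x) (nsets (X - B - {x}) (k - 1)) ?S"
  proof (rule bij_betw_byWitness[where f' = "\<lambda>F. F - {x}"])
    show "insert x ` nsets (X - B - {x}) (k - 1) \<subseteq> ?S"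
      using x k by (auto simp: nsets_def card_insert_if)
  qed (auto simp: nsets_def)
  then have "card ?S = card (nsets (X - B - {x}) (k - 1))" by (rule bij_betw_same_card[symmetric])
  also have "card (X - B - {x}) = card X - k - 1"
    using X B x by (auto simp: nsets_def card_Diff_subset)
  then have "card (nsets (X - B - {x}) (k - 1)) = (card X - k - 1) choose (k - 1)" by simp
  moreover have "B \<notin> ?S" using B x by (auto simp: nsets_def)
  ultimately show ?thesis using finS by (simp add: \<E>_def)
qed

lemma matching_number_set_plus_star:
  assumes "2 * k \<le> card X"
  shows "2 \<le> matching_number \<E>"
proof -
  have fin\<E>: "finite \<E>" using X finite_imp_finite_nsets[of "X - B" k] by (simp add: \<E>_def)
  have "card (X - B) = card X - k" using X B by (auto simp: nsets_def card_Diff_subset)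
  then have "k \<le> card (X - B)" using assms by simp
  then obtain F where "{x} \<subseteq> F" "F \<subseteq> X - B" "card F = k"
    using exists_subset_between[of "{x}" k "X - B"] x k X by auto
  then have "F \<in> \<E>" "F \<inter> B = {}" using X by (auto simp: \<E>_def nsets_def finite_subset)
  moreover have "{} \<notin> \<E>" using B k by (auto simp: \<E>_def nsets_def)
  ultimately show ?thesis using matching_number_ge_2_iff[OF fin\<E>] by (auto simp: \<E>_def)
qed

end

lemma (in three_cluster_free) matching_number_2_bound:
  assumes nu: "2 \<le> matching_number \<F>"
    and large: "3 * k + 2 * 2 ^ (2 * k) + 2 * 2 ^ core_deficit k + 1 \<le> card X"
  defines "c \<equiv> (card X - k - 1) choose (k - 1)"
  shows "card \<F> \<le> c + 1 \<and> (card \<F> = c + 1 \<longrightarrow>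
    (\<exists>B x. B \<in> [X]\<^bsup>k\<^esup> \<and> x \<in> X - B \<and> \<F> = {B} \<union> {F \<in> [X - B]\<^bsup>k\<^esup>. x \<in> F}))"
proof (cases "c \<le> card \<F>")
  case True
  have "core_deficit k < 2 ^ core_deficit k" by (rule less_exp)
  then have "core_deficit k < card X" using large by linarith
  then obtain x where x: "x \<in> X" "card {B \<in> \<F>. x \<notin> B} \<le> 2 ^ core_deficit k"
    using near_star_exists True unfolding c_def by blast
  have "{} \<notin> \<F>" using memD(3)[of "{}"] k_ge_3 by auto
  \<comment> \<open>Two disjoint members cannot both contain \<open>x\<close>; this supplies the set
    \<open>B\<close> needed for \<open>near_star_bound\<close>.\<close>
  then obtain A A' where "A \<in> \<F>" "A' \<in> \<F>" "A \<inter> A' = {}"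
    using nu matching_number_ge_2_iff[OF finite_\<F>] by blast
  then obtain B where B: "B \<in> \<F>" "x \<notin> B" by blast
  have "B \<in> [X]\<^bsup>k\<^esup>" "x \<in> X - B" using B x \<F>_sub by auto
  then show ?thesis using near_star_bound[OF x(1) B x(2) large] unfolding c_def by blast
qed simp

theorem theorem1p9:
  fixes k :: nat
  assumes "k \<ge> 3"
  shows "\<exists>n\<^sub>0. \<forall>n\<ge>n\<^sub>0.
    max_cluster_free n k 3 1 = ((n - k - 1) choose (k - 1)) + 1 \<and>
    (\<forall>\<F>. \<F> \<subseteq> [{1..n}]\<^bsup>k\<^esup> \<and> cluster_free k 3 \<F> \<and> matching_number \<F> \<ge> 2 \<and>
          card \<F> = ((n - k - 1) choose (k - 1)) + 1 \<longrightarrow>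
       (\<exists>B x. B \<in> [{1..n}]\<^bsup>k\<^esup> \<and> x \<in> {1..n} - B \<and>
          \<F> = {B} \<union> {F \<in> [{1..n} - B]\<^bsup>k\<^esup>. x \<in> F}))"
proof (intro exI allI impI)
  fix n :: nat
  \<comment> \<open>This is the threshold of \<open>near_star_bound\<close> with
    \<open>b = 2 ^ core_deficit k\<close>, the bound from \<open>near_star_exists\<close>.\<close>
  assume n: "n \<ge> 3 * k + 2 * 2 ^ (2 * k) + 2 * 2 ^ core_deficit k + 1"
  let ?c = "(n - k - 1) choose (k - 1)"
  have bound: "card \<F> \<le> ?c + 1 \<and> (card \<F> = ?c + 1 \<longrightarrow>
      (\<exists>B x. B \<in> [{1..n}]\<^bsup>k\<^esup> \<and> x \<in> {1..n} - B \<and> \<F> = {B} \<union> {F \<in> [{1..n} - B]\<^bsup>k\<^esup>. x \<in> F}))"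
    if "\<F> \<subseteq> [{1..n}]\<^bsup>k\<^esup>" "cluster_free k 3 \<F>" "matching_number \<F> \<ge> 2" for \<F>
  proof -
    interpret three_cluster_free "{1..n}" k \<F>
      using that assms by unfold_locales auto
    show ?thesis using matching_number_2_bound that(3) n by simp
  qed
  let ?B = "{1..k}" and ?x = "k + 1"
  let ?E = "{?B} \<union> {F \<in> [{1..n} - ?B]\<^bsup>k\<^esup>. ?x \<in> F}"
  have B: "?B \<in> [{1..n}]\<^bsup>k\<^esup>" and x: "?x \<in> {1..n} - ?B" using n by (auto simp: nsets_def)
  have "admissible n k 3 1 ?E"
    unfolding admissible_def
    using set_plus_star_cluster_free[OF _ B x assms] matching_number_set_plus_star[OF _ B x assms]
      nsets_mono[of "{1..n} - ?B" "{1..n}" k] B n by auto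
  moreover have "card ?E = ?c + 1" using card_set_plus_star[OF _ B x assms] by simp
  ultimately have attained: "?c + 1 \<in> {card \<F> |\<F>. admissible n k 3 1 \<F>}" by force
  have upper: "m \<le> ?c + 1" if m: "m \<in> {card \<F> |\<F>. admissible n k 3 1 \<F>}" for m
  proof -
    obtain \<F> where "m = card \<F>" "admissible n k 3 1 \<F>" using m by blast
    then show ?thesis using bound[of \<F>] unfolding admissible_def by simp
  qed
  \<comment> \<open>The upper bound makes the set of sizes finite, so that \<open>Max\<close> is its
    true maximum.\<close>
  then have "finite {card \<F> |\<F>. admissible n k 3 1 \<F>}"
    by (intro finite_subset[OF subsetI finite_atMost[of "?c + 1"]]) (simp only: atMost_iff)
  then have "max_cluster_free n k 3 1 = ?c + 1"
    unfolding max_cluster_free_def using upper attained by (rule Max_eqI)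
  then show "max_cluster_free n k 3 1 = ?c + 1 \<and>
    (\<forall>\<F>. \<F> \<subseteq> [{1..n}]\<^bsup>k\<^esup> \<and> cluster_free k 3 \<F> \<and> matching_number \<F> \<ge> 2 \<and>
          card \<F> = ?c + 1 \<longrightarrow>
       (\<exists>B x. B \<in> [{1..n}]\<^bsup>k\<^esup> \<and> x \<in> {1..n} - B \<and>
          \<F> = {B} \<union> {F \<in> [{1..n} - B]\<^bsup>k\<^esup>. x \<in> F}))"
    using bound by blast
qed

end
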